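(* Let $f\colon\mathbb{R}^d\to\mathbb{R}$ be twice differentiable, and let $H>0$ be a constant such that for all $x,y\in\mathbb{R}^d$ $$f(y)\le f(x)+\langle\nabla f(x),y-x\rangle+\tfrac12\langle\nabla^2 f(x)(y-x),y-x\rangle+\tfrac{H}{3}\|y-x\|^3,$$ $$\|\nabla f(y)-\nabla f(x)-\nabla^2 f(x)(y-x)\|\le H\|x-y\|^2.$$ Assume that $f$ is $\mu$-strongly convex with $\mu>0$, i.e. $\nabla^2 f(x)\succcurlyeq\mu\mathbf{I}$ for every $x\in\mathbb{R}^d$. Let $x^0\in\mathbb{R}^d$ and $$x^{k+1}=x^k-\bigl(\nabla^2 f(x^k)+\lambda_k\mathbf{I}\bigr)^{-1}\nabla f(x^k),\qquad \lambda_k=\sqrt{H\|\nabla f(x^k)\|},\qquad k=0,1,2,\dots.$$ If for some $k_0\ge 0$ it holds $\|\nabla f(x^{k_0})\|\le\frac{\mu^2}{4H}$, then for all $k\ge k_0$ $$\|\nabla f(x^{k+1})\|\le\frac{2\sqrt{H}}{\mu}\|\nabla f(x^k)\|^{3/2},$$ and, therefore, the sequence $(x^k)_{k\ge k_0}$ converges superlinearly.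
   Context: $\|\cdot\|$ is the Euclidean norm on $\mathbb{R}^d$; $\mathbf{I}$ is the identity matrix; $A\succcurlyeq B$ means $A-B$ is positive semi-definite. "Converges superlinearly" means that $x^k\to x^*$, where $x^*$ is the unique minimizer of $f$, and for every $\varepsilon>0$ there is $K$ such that $\|x^{k+1}-x^*\|\le\varepsilon\|x^k-x^*\|$ for all $k\ge K$. *)

theory Defs
  imports "HOL-Analysis.Analysis"
begin

(* Only the quadratic form is constrained. Symmetry is not demanded: the Hessian of a
   twice Frechet differentiable function is symmetric anyway. *)
definition pos_semidef :: "real ^ 'n ^ 'n \<Rightarrow> bool" where
  "pos_semidef A \<longleftrightarrow> (\<forall>v. 0 \<le> (A *v v) \<bullet> v)"

definition loewner_ge :: "real ^ 'n ^ 'n \<Rightarrow> real ^ 'n ^ 'n \<Rightarrow> bool"  (infix "\<succeq>\<^sub>L" 50) where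
  "A \<succeq>\<^sub>L B \<longleftrightarrow> pos_semidef (A - B)"

definition unique_minimizer :: "('a \<Rightarrow> real) \<Rightarrow> 'a \<Rightarrow> bool" where
  "unique_minimizer f z \<longleftrightarrow>
     is_arg_min f (\<lambda>_. True) z \<and> (\<forall>y. is_arg_min f (\<lambda>_. True) y \<longrightarrow> y = z)"

(* Phrased without quotients, so that sequences reaching their limit are covered. *)
definition converges_superlinearly :: "(nat \<Rightarrow> 'a::real_normed_vector) \<Rightarrow> 'a \<Rightarrow> bool" where
  "converges_superlinearly x z \<longleftrightarrow>
     x \<longlonglongrightarrow> z \<and>
     (\<forall>\<epsilon>>0. \<exists>K. \<forall>k\<ge>K. norm (x (Suc k) - z) \<le> \<epsilon> * norm (x k - z))"

end

theory Submission
  imports Defs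
begin

text \<open>
  Put \<open>g\<^sub>k = norm (grad (x k))\<close> and let \<open>h = x (k + 1) - x k\<close>. Strong convexity gives
  \<open>norm h \<le> g\<^sub>k / (\<mu> + \<lambda>\<^sub>k)\<close>, and since \<open>h\<close> solves the regularised Newton equation,
  \<open>g\<^sub>k\<^sub>+\<^sub>1 \<le> H * (norm h)\<^sup>2 + \<lambda>\<^sub>k * norm h\<close>. The choice \<open>\<lambda>\<^sub>k\<^sup>2 = H * g\<^sub>k\<close> balances both terms:
  \<open>g\<^sub>k\<^sub>+\<^sub>1 \<le> 2 * \<lambda>\<^sub>k / (\<mu> + \<lambda>\<^sub>k) * g\<^sub>k\<close>. This is the claimed estimate, and it contracts by
  \<open>2 / 3\<close> as soon as \<open>2 * \<lambda>\<^sub>k \<le> \<mu>\<close>, which is the starting condition. As the gradient is strongly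
  monotone, convergence of the gradients to \<open>0\<close> makes \<open>x\<close> a Cauchy sequence; its limit is
  the minimizer, near which \<open>g\<^sub>k\<close> and the distance to the minimizer are comparable.
\<close>

lemma loewner_ge_imp_coercive:
  assumes "A \<succeq>\<^sub>L \<mu> *\<^sub>R mat 1"
  shows "\<mu> * (norm v)\<^sup>2 \<le> (A *v v) \<bullet> v"
proof -
  have "0 \<le> ((A - \<mu> *\<^sub>R mat 1) *v v) \<bullet> v"
    using assms by (simp add: loewner_ge_def pos_semidef_def)
  also have "(A - \<mu> *\<^sub>R mat 1) *v v = A *v v - \<mu> *\<^sub>R v"
    by (simp add: matrix_vector_mult_diff_rdistrib flip: scaleR_matrix_vector_assoc)
  finally show ?thesis
    by (simp add: inner_diff_left power2_norm_eq_inner)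
qed

text \<open>Cauchy-Schwarz, divided by \<open>norm v\<close>. It serves twice: with
  \<open>w = A *v v\<close> for coercive matrices and with \<open>w\<close> a difference of
  gradients.\<close>

lemma coercive_imp_norm_ge:
  fixes v w :: "'a::real_inner"
  assumes "\<mu> * (norm v)\<^sup>2 \<le> w \<bullet> v"
  shows "\<mu> * norm v \<le> norm w"
proof (cases "v = 0")
  case False
  have "(\<mu> * norm v) * norm v \<le> norm w * norm v"
    using assms norm_cauchy_schwarz[of w v] by (simp add: power2_eq_square mult.assoc)
  then show ?thesis
    using False by simp
qed simp

text \<open>Coercivity makes the kernel trivial, which in finite dimension gives invertibility. Only
  then is \<open>matrix_inv\<close>, defined by choice, known to be a true inverse.\<close>

lemma matrix_inv_coercive:
  fixes A :: "real ^ 'd ^ 'd"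
  assumes c: "c > 0" and A: "\<And>v. c * (norm v)\<^sup>2 \<le> (A *v v) \<bullet> v"
  shows "A *v (matrix_inv A *v b) = b" and "norm (matrix_inv A *v b) \<le> norm b / c"
proof -
  have "v = 0" if "A *v v = 0" for v
    using coercive_imp_norm_ge[OF A[of v]] that c by (simp add: mult_le_0_iff)
  then have "invertible A"
    by (simp add: invertible_left_inverse matrix_left_invertible_ker)
  then have "A ** matrix_inv A = mat 1"
    unfolding invertible_def matrix_inv_def by (rule someI2_ex) simp
  then show inv: "A *v (matrix_inv A *v b) = b"
    by (simp add: matrix_vector_mul_assoc)
  show "norm (matrix_inv A *v b) \<le> norm b / c"
    using coercive_imp_norm_ge[OF A[of "matrix_inv A *v b"]] c
    by (simp add: inv field_simps)
qed

lemma GDERIV_mvt_segment: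
  assumes "\<And>u. GDERIV f u :> grad u"
  obtains t where "0 < t" "t < 1" "f v - f u = grad (u + t *\<^sub>R (v - u)) \<bullet> (v - u)"
proof -
  have "((\<lambda>t. f (u + t *\<^sub>R (v - u))) has_real_derivative grad (u + t *\<^sub>R (v - u)) \<bullet> (v - u)) (at t)"
    for t :: real
  proof -
    have f': "(f has_derivative (\<lambda>h. h \<bullet> grad (u + t *\<^sub>R (v - u)))) (at (u + t *\<^sub>R (v - u)))"
      using assms by (simp add: gderiv_def)
    have "((\<lambda>t. u + t *\<^sub>R (v - u)) has_derivative (\<lambda>s. s *\<^sub>R (v - u))) (at t)"
      by (auto intro!: derivative_eq_intros)
    from has_derivative_compose[OF this f'] show ?thesis
      by (simp add: has_field_derivative_def inner_commute mult_commute_abs)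
  qed
  from MVT2[of 0 1, OF _ this] show ?thesis
    using that by auto
qed

text \<open>The mean value theorem has no equality form for vector-valued maps, so it is applied to
  the scalar function obtained by pairing the gradient along the segment with
  \<open>v - u\<close>.\<close>

lemma gradient_strongly_monotone:
  fixes grad :: "real ^ 'd \<Rightarrow> real ^ 'd"
  assumes hess: "\<And>u. (grad has_derivative (\<lambda>h. hess u *v h)) (at u)"
    and coercive: "\<And>u h. \<mu> * (norm h)\<^sup>2 \<le> (hess u *v h) \<bullet> h"
  shows "\<mu> * (norm (v - u))\<^sup>2 \<le> (grad v - grad u) \<bullet> (v - u)"
proof -
  have "((\<lambda>t. grad (u + t *\<^sub>R (v - u)) \<bullet> (v - u)) has_real_derivative
      (hess (u + t *\<^sub>R (v - u)) *v (v - u)) \<bullet> (v - u)) (at t)" for t :: real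
  proof -
    have "((\<lambda>t. u + t *\<^sub>R (v - u)) has_derivative (\<lambda>s. s *\<^sub>R (v - u))) (at t)"
      by (auto intro!: derivative_eq_intros)
    from has_derivative_inner_left[OF has_derivative_compose[OF this hess], of "v - u"]
    show ?thesis
      by (simp add: has_field_derivative_def matrix_vector_mult_scaleR mult_commute_abs)
  qed
  from MVT2[of 0 1, OF _ this] obtain t :: real where
    "grad v \<bullet> (v - u) - grad u \<bullet> (v - u) = (hess (u + t *\<^sub>R (v - u)) *v (v - u)) \<bullet> (v - u)"
    by auto
  then show ?thesis
    using coercive[of "v - u"] by (simp add: inner_diff_left)
qed

text \<open>Since the gradient vanishes at \<open>z\<close>, strong monotonicity makes every
  directional derivative pointing away from \<open>z\<close> positive.\<close>

lemma unique_minimizer_critical_point: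
  assumes grad: "\<And>u. GDERIV f u :> grad u" and "\<mu> > 0"
    and mono: "\<And>u v. \<mu> * (norm (v - u))\<^sup>2 \<le> (grad v - grad u) \<bullet> (v - u)"
    and z: "grad z = 0"
  shows "unique_minimizer f z"
proof -
  have less: "f z < f y" if "y \<noteq> z" for y
  proof -
    obtain t where t: "0 < t" "t < 1" and f: "f y - f z = grad (z + t *\<^sub>R (y - z)) \<bullet> (y - z)"
      using GDERIV_mvt_segment[OF grad] by blast
    \<comment> \<open>Monotonicity is used between \<open>z\<close> and the intermediate point;
      their difference is \<open>t *\<^sub>R (y - z)\<close>, whence the factor \<open>t\<close> in
      the next bound.\<close>
    have "0 < \<mu> * (norm (t *\<^sub>R (y - z)))\<^sup>2"
      using that t \<open>\<mu> > 0\<close> by simp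
    also have "\<dots> \<le> t * (f y - f z)"
      using mono[of "z + t *\<^sub>R (y - z)" z] by (simp add: z f)
    finally show ?thesis
      using t by (simp add: zero_less_mult_iff)
  qed
  then have "f z \<le> f y" for y
    by (cases "y = z") (auto intro: less_imp_le)
  with less show ?thesis
    by (auto simp: unique_minimizer_def is_arg_min_linorder not_le[symmetric])
qed

text \<open>The remainder bound at \<open>u'\<close> controls \<open>grad u' - l *\<^sub>R h\<close>
  with \<open>h = u - u'\<close>, because the step equation cancels \<open>grad u\<close> up to the
  regularising term.\<close>

lemma regularized_newton_step:
  fixes grad :: "real ^ 'd \<Rightarrow> real ^ 'd"
  assumes "H > 0" "\<mu> > 0"
    and coercive: "\<And>h. \<mu> * (norm h)\<^sup>2 \<le> (A *v h) \<bullet> h"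
    and remainder: "\<And>v. norm (grad v - grad u - A *v (v - u)) \<le> H * (norm (u - v))\<^sup>2"
    and lam: "l = sqrt (H * norm (grad u))"
    and step: "u' = u - matrix_inv (A + l *\<^sub>R mat 1) *v grad u"
  shows "norm (grad u') \<le> 2 * l / (\<mu> + l) * norm (grad u)"
proof -
  define B where "B = A + l *\<^sub>R mat 1"
  define h where "h = matrix_inv B *v grad u"
  have l: "0 \<le> l" and l2: "H * norm (grad u) = l\<^sup>2"
    using \<open>H > 0\<close> by (simp_all add: lam)
  have c: "0 < \<mu> + l"
    using l \<open>\<mu> > 0\<close> by simp
  have B_mult: "B *v v = A *v v + l *\<^sub>R v" for v
    by (simp add: B_def matrix_vector_mult_add_rdistrib flip: scaleR_matrix_vector_assoc)
  have B: "(\<mu> + l) * (norm v)\<^sup>2 \<le> (B *v v) \<bullet> v" for v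
    using coercive[of v] by (simp add: B_mult inner_add_left algebra_simps power2_norm_eq_inner)
  have eq: "A *v h + l *\<^sub>R h = grad u"
    using matrix_inv_coercive(1)[OF c B, where b = "grad u"] by (simp add: B_mult flip: h_def)
  have h: "norm h \<le> norm (grad u) / (\<mu> + l)"
    unfolding h_def by (rule matrix_inv_coercive(2)[OF c B])
  have h_eq: "u - u' = h"
    by (simp add: step h_def B_def)
  have "A *v (u' - u) = - (A *v h)"
    using linear_neg[OF matrix_vector_mul_linear, of A h] by (simp flip: h_eq)
  then have "grad u' - grad u - A *v (u' - u) = grad u' - l *\<^sub>R h"
    by (simp flip: eq)
  then have "norm (grad u' - l *\<^sub>R h) \<le> H * (norm h)\<^sup>2"
    using remainder[of u'] by (simp only: h_eq)
  then have "norm (grad u') \<le> H * (norm h)\<^sup>2 + l * norm h"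
    using norm_triangle_sub[of "grad u'" "l *\<^sub>R h"] l by simp
  also have "\<dots> \<le> H * (norm (grad u) / (\<mu> + l))\<^sup>2 + l * (norm (grad u) / (\<mu> + l))"
    using h l \<open>H > 0\<close> by (intro add_mono mult_left_mono power_mono) auto
  \<comment> \<open>One factor \<open>norm (grad u)\<close> is absorbed by
    \<open>l\<^sup>2 = H * norm (grad u)\<close>. The remaining ratio is at most 1, so its square
    can be replaced by the ratio itself.\<close>
  also have "H * (norm (grad u) / (\<mu> + l))\<^sup>2 = (l / (\<mu> + l))\<^sup>2 * norm (grad u)"
    by (simp add: power_divide power2_eq_square flip: l2[unfolded power2_eq_square])
  also have "\<dots> \<le> l / (\<mu> + l) * norm (grad u)"
    using l \<open>\<mu> > 0\<close> power_decreasing[of 1 2 "l / (\<mu> + l)"] by (intro mult_right_mono) auto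
  finally show ?thesis
    by (simp add: algebra_simps)
qed

theorem theorem2:
  fixes f :: "real ^ 'd \<Rightarrow> real"
    and grad :: "real ^ 'd \<Rightarrow> real ^ 'd"
    and hess :: "real ^ 'd \<Rightarrow> real ^ 'd ^ 'd"
    and H \<mu> :: real
    and x :: "nat \<Rightarrow> real ^ 'd"
    and lam :: "nat \<Rightarrow> real"
    and k0 :: nat
  assumes grad: "\<And>u. GDERIV f u :> grad u"
    and hess: "\<And>u. (grad has_derivative (\<lambda>h. hess u *v h)) (at u)"
    and H_pos: "H > 0"
    and upper: "\<And>u v. f v \<le> f u + grad u \<bullet> (v - u)
                  + 1 / 2 * ((hess u *v (v - u)) \<bullet> (v - u)) + H / 3 * norm (v - u) ^ 3"
    and grad_lip: "\<And>u v. norm (grad v - grad u - hess u *v (v - u)) \<le> H * (norm (u - v))\<^sup>2"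
    and mu_pos: "\<mu> > 0"
    and strongly_convex: "\<And>u. hess u \<succeq>\<^sub>L \<mu> *\<^sub>R mat 1"
    and lam: "\<And>k. lam k = sqrt (H * norm (grad (x k)))"
    and step: "\<And>k. x (Suc k) = x k - matrix_inv (hess (x k) + lam k *\<^sub>R mat 1) *v grad (x k)"
    and start: "norm (grad (x k0)) \<le> \<mu>\<^sup>2 / (4 * H)"
  shows "(\<forall>k\<ge>k0. norm (grad (x (Suc k)))
                     \<le> 2 * sqrt H / \<mu> * norm (grad (x k)) powr (3 / 2)) \<and>
         (\<exists>z. unique_minimizer f z \<and> converges_superlinearly (\<lambda>k. x (k0 + k)) z)"
proof -

  \<comment> \<open>The 3/2-power estimate for the gradient norms\<close>
  define g where "g k = norm (grad (x k))" for k
  have coercive: "\<mu> * (norm h)\<^sup>2 \<le> (hess u *v h) \<bullet> h" for u h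
    using strongly_convex by (rule loewner_ge_imp_coercive)
  note mono = gradient_strongly_monotone[OF hess coercive]
  have expand: "\<mu> * norm (v - u) \<le> norm (grad v - grad u)" for u v
    using mono by (rule coercive_imp_norm_ge)
  have g0: "0 \<le> g k" for k
    by (simp add: g_def)
  have lam_eq: "lam k = sqrt H * sqrt (g k)" for k
    by (simp add: lam g_def real_sqrt_mult)
  have lam0: "0 \<le> lam k" for k
    using H_pos by (simp add: lam)
  have newton: "g (Suc k) \<le> 2 * lam k / (\<mu> + lam k) * g k" for k
    unfolding g_def
    by (rule regularized_newton_step[OF H_pos mu_pos coercive grad_lip lam step])
  have rate: "g (Suc k) \<le> 2 * lam k / \<mu> * g k" for k
  proof -
    have "2 * lam k / (\<mu> + lam k) * g k \<le> 2 * lam k / \<mu> * g k"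
      using mu_pos lam0[of k] g0[of k] by (intro mult_right_mono divide_left_mono) auto
    with newton show ?thesis
      by (rule order_trans)
  qed
  have powr: "sqrt (g k) * g k = g k powr (3 / 2)" for k
  proof (cases "g k = 0")
    case False
    then have "g k powr (1 / 2 + 1) = g k powr (1 / 2) * g k"
      using g0[of k] by (subst powr_add) simp
    then show ?thesis
      using g0[of k] by (simp add: powr_half_sqrt)
  qed simp
  have estimate: "g (Suc k) \<le> 2 * sqrt H / \<mu> * g k powr (3 / 2)" for k
    using rate[of k] by (simp add: lam_eq mult.assoc flip: powr)

  \<comment> \<open>Geometric decay of the gradient norms\<close>
  have small: "lam k \<le> \<mu> / 2" if "g k \<le> \<mu>\<^sup>2 / (4 * H)" for k
  proof -
    have "H * g k \<le> (\<mu> / 2)\<^sup>2"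
      using that H_pos by (simp add: field_simps)
    then show ?thesis
      unfolding lam g_def[symmetric] using mu_pos by (intro real_le_lsqrt) auto
  qed
  have contract: "g (Suc k) \<le> 2 / 3 * g k" if "g k \<le> \<mu>\<^sup>2 / (4 * H)" for k
  proof -
    \<comment> \<open>The summand \<open>lam k\<close> in the denominator matters: at
      \<open>lam k = \<mu> / 2\<close> the cruder factor \<open>2 * lam k / \<mu>\<close> equals 1
      and gives no contraction.\<close>
    have "2 * lam k / (\<mu> + lam k) \<le> 2 / 3"
      using small[OF that] lam0[of k] mu_pos by (simp add: field_simps)
    then have "2 * lam k / (\<mu> + lam k) * g k \<le> 2 / 3 * g k"
      using g0 by (rule mult_right_mono)
    with newton show ?thesis
      by (rule order_trans)
  qed
  have geometric: "g (k0 + k) \<le> (2 / 3) ^ k * g k0" for k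
  proof (induction k)
    case (Suc k)
    \<comment> \<open>The decay so far keeps the gradient norm below the starting threshold, so the
      contraction applies again.\<close>
    have "(2 / 3) ^ k * g k0 \<le> g k0"
      using g0 by (intro mult_left_le_one_le) (auto intro: power_le_one)
    then have "g (k0 + k) \<le> \<mu>\<^sup>2 / (4 * H)"
      using Suc.IH start by (simp add: g_def)
    from contract[OF this] show ?case
      using Suc.IH by simp
  qed simp

  \<comment> \<open>Convergence of the iterates to a critical point\<close>
  define y where "y k = x (k0 + k)" for k
  have g_lim: "(\<lambda>k. g (k0 + k)) \<longlonglongrightarrow> 0"
  proof (rule tendsto_sandwich[OF _ _ tendsto_const])
    show "(\<lambda>k. (2 / 3) ^ k * g k0) \<longlonglongrightarrow> 0"
      by (intro tendsto_mult_left_zero LIMSEQ_realpow_zero) auto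
  qed (use geometric g0 in \<open>auto intro: always_eventually\<close>)
  then have grad_lim: "(\<lambda>k. grad (y k)) \<longlonglongrightarrow> 0"
    by (simp add: g_def y_def tendsto_norm_zero_iff)
  have "Cauchy y"
  proof (rule metric_CauchyI)
    fix e :: real
    assume "e > 0"
    then obtain M where M: "dist (grad (y m)) (grad (y n)) < \<mu> * e" if "m \<ge> M" "n \<ge> M" for m n
      using metric_CauchyD[OF LIMSEQ_imp_Cauchy[OF grad_lim], of "\<mu> * e"] mu_pos by auto
    have "dist (y m) (y n) < e" if "m \<ge> M" "n \<ge> M" for m n
    proof -
      have "\<mu> * dist (y m) (y n) < \<mu> * e"
        using expand[of "y m" "y n"] M[OF that] by (simp add: dist_norm)
      then show ?thesis
        using mu_pos by simp
    qed
    then show "\<exists>M. \<forall>m\<ge>M. \<forall>n\<ge>M. dist (y m) (y n) < e"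
      by blast
  qed
  then obtain z where z: "y \<longlonglongrightarrow> z"
    by (auto simp: Cauchy_convergent_iff convergent_def)
  have "(\<lambda>k. grad (y k)) \<longlonglongrightarrow> grad z"
    using has_derivative_continuous[OF hess] z by (rule isCont_tendsto_compose)
  with grad_lim have grad_z: "grad z = 0"
    by (rule LIMSEQ_unique[symmetric])

  \<comment> \<open>Superlinear rate near the minimizer\<close>
  define L where "L = onorm ((*v) (hess z)) + H"
  have bl: "bounded_linear ((*v) (hess z))"
    by (rule matrix_vector_mul_bounded_linear)
  have L0: "0 < L"
    using onorm_pos_le[OF bl] H_pos by (simp add: L_def)
  \<comment> \<open>Within the unit ball around \<open>z\<close> the quadratic remainder is at most
    linear; the summand \<open>H\<close> of \<open>L\<close> absorbs it.\<close>
  have lipschitz: "norm (grad v) \<le> L * norm (v - z)" if "norm (v - z) \<le> 1" for v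
  proof -
    have "norm (grad v) \<le> norm (hess z *v (v - z)) + norm (grad v - hess z *v (v - z))"
      by (rule norm_triangle_sub)
    also have "\<dots> \<le> onorm ((*v) (hess z)) * norm (v - z) + H * (norm (v - z))\<^sup>2"
      using grad_lip[of v z] by (intro add_mono onorm[OF bl]) (simp add: grad_z norm_minus_commute)
    also have "(norm (v - z))\<^sup>2 \<le> norm (v - z)"
      using that by (auto simp: power2_eq_square intro!: mult_left_le)
    finally show ?thesis
      using H_pos by (simp add: L_def algebra_simps)
  qed
  have "converges_superlinearly y z"
    unfolding converges_superlinearly_def
  proof (intro conjI allI impI z)
    fix e :: real
    assume e: "e > 0"
    have "(\<lambda>k. lam (k0 + k)) \<longlonglongrightarrow> sqrt H * sqrt 0"
      unfolding lam_eq by (intro tendsto_intros g_lim)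
    \<comment> \<open>The threshold is chosen so that the factor \<open>2 / \<mu>\<close> of
      \<open>rate\<close> and the constant \<open>L\<close> together leave exactly
      \<open>\<mu> * e\<close>; the last \<open>\<mu>\<close> cancels against
      \<open>expand\<close>.\<close>
    then have "\<forall>\<^sub>F k in sequentially. lam (k0 + k) < e * \<mu>\<^sup>2 / (2 * L)"
      by (rule order_tendstoD) (use e mu_pos L0 in simp)
    moreover have "\<forall>\<^sub>F k in sequentially. dist (y k) z < 1"
      using z by (rule tendstoD) simp
    ultimately have "\<forall>\<^sub>F k in sequentially. norm (y (Suc k) - z) \<le> e * norm (y k - z)"
    proof eventually_elim
      case (elim k)
      have "\<mu> * norm (y (Suc k) - z) \<le> g (k0 + Suc k)"
        using expand[of "y (Suc k)" z] by (simp add: grad_z g_def y_def)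
      also have "\<dots> \<le> 2 * lam (k0 + k) / \<mu> * g (k0 + k)"
        using rate by simp
      also have "\<dots> \<le> 2 * (e * \<mu>\<^sup>2 / (2 * L)) / \<mu> * (L * norm (y k - z))"
        using elim lipschitz[of "y k"] lam0 g0 mu_pos e L0
        by (intro mult_mono divide_right_mono) (auto simp: g_def y_def dist_norm)
      also have "\<dots> = \<mu> * (e * norm (y k - z))"
        using mu_pos L0 by (simp add: power2_eq_square)
      finally show ?case
        using mu_pos by simp
    qed
    then show "\<exists>K. \<forall>k\<ge>K. norm (y (Suc k) - z) \<le> e * norm (y k - z)"
      by (simp add: eventually_sequentially)
  qed
  moreover have "unique_minimizer f z"
    using grad mu_pos mono grad_z by (rule unique_minimizer_critical_point)
  ultimately show ?thesis
    using estimate by (auto simp: g_def y_def[abs_def])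
qed

end
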